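(* For $i\in\{1,2\}$, $s_i(n,\# P_4,\mathcal{C})=\frac{n^2}{16}+O(n)$; that is, there are bounds of the form $\frac{n^2}{16}+O(n)\le s_i(n,\# P_4,\mathcal{C})\le \frac{n^2}{16}+O(n)$.
   Context: Let $\mathcal{C}=\{C_3,C_4,\dots\}$ be the family of all cycles. In the $\mathcal{C}$-saturation game on $n$ vertices, Max and Mini alternately claim previously unclaimed edges of $K_n$ so that the graph of claimed edges contains no cycle; the game ends when the graph is a spanning tree. The $H$-score is the number of (not necessarily induced) subgraphs of the final graph isomorphic to $H$. Max maximizes and Mini minimizes; $s_1$ denotes the optimal score when Max starts, $s_2$ when Mini starts. $P_4$ is the path on 4 vertices. *)

theory Defs
  imports Complex_Main "HOL-Library.Landau_Symbols"
begin

text \<open>A graph is a pair of a vertex set and a set of edges, edges being two-element sets of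
  vertices.\<close>

type_synonym 'a graph = "'a set \<times> 'a set set"

abbreviation verts :: "'a graph \<Rightarrow> 'a set" where
  "verts \<equiv> fst"

abbreviation edges :: "'a graph \<Rightarrow> 'a set set" where
  "edges \<equiv> snd"

definition all_edges :: "'a set \<Rightarrow> 'a set set" where
  "all_edges V = {e. e \<subseteq> V \<and> card e = 2}"

definition is_subgraph :: "'a graph \<Rightarrow> 'a graph \<Rightarrow> bool" where
  "is_subgraph S G \<longleftrightarrow>
     verts S \<subseteq> verts G \<and> edges S \<subseteq> edges G \<and> edges S \<subseteq> all_edges (verts S)"

definition isomorphic :: "'a graph \<Rightarrow> 'b graph \<Rightarrow> bool" where
  "isomorphic G H \<longleftrightarrow> (\<exists>f. bij_betw f (verts G) (verts H) \<and> (\<lambda>e. f ` e) ` edges G = edges H)"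

definition copies :: "'b graph \<Rightarrow> 'a graph \<Rightarrow> 'a graph set" where
  "copies H G = {S. is_subgraph S G \<and> isomorphic S H}"

definition free_of :: "'b graph set \<Rightarrow> 'a graph \<Rightarrow> bool" where
  "free_of \<F> G \<longleftrightarrow> (\<forall>F\<in>\<F>. copies F G = {})"

text \<open>\<open>path_graph k\<close> and \<open>cycle_graph k\<close> have \<open>k\<close> vertices; the latter is a cycle only for
  \<open>k \<ge> 3\<close>.\<close>

definition path_graph :: "nat \<Rightarrow> nat graph" where
  "path_graph k = ({..<k}, {{i, i + 1} | i. i + 1 < k})"

definition cycle_graph :: "nat \<Rightarrow> nat graph" where
  "cycle_graph k = ({..<k}, {{i, (i + 1) mod k} | i. i < k})"

definition cycles :: "nat graph set" where
  "cycles = {cycle_graph k | k. k \<ge> 3}"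

datatype player = Maxi | Mini

fun opponent :: "player \<Rightarrow> player" where
  "opponent Maxi = Mini"
| "opponent Mini = Maxi"

definition legal_moves :: "nat \<Rightarrow> 'b graph set \<Rightarrow> nat set set \<Rightarrow> nat set set" where
  "legal_moves n \<F> E =
     {e \<in> all_edges {..<n} - E. free_of \<F> ({..<n}, insert e E)}"

lemma finite_all_edges: "finite V \<Longrightarrow> finite (all_edges V)"
  unfolding all_edges_def by (rule finite_subset[of _ "Pow V"]) auto

lemma card_remaining_less:
  assumes "e \<in> legal_moves n \<F> E"
  shows "card (all_edges {..<n} - insert e E) < card (all_edges {..<n} - E)"
  using assms
  by (intro psubset_card_mono) (auto simp: legal_moves_def finite_all_edges)

text \<open>\<open>game_value n H \<F> p E\<close> is the \<open>H\<close>-score under optimal play from the position with claimed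
  edge set \<open>E\<close> and player \<open>p\<close> to move.\<close>

function game_value :: "nat \<Rightarrow> 'a graph \<Rightarrow> 'b graph set \<Rightarrow> player \<Rightarrow> nat set set \<Rightarrow> nat" where
  "game_value n H \<F> p E =
     (if legal_moves n \<F> E = {} then card (copies H ({..<n}, E))
      else case p of
        Maxi \<Rightarrow> Max ((\<lambda>e. game_value n H \<F> (opponent p) (insert e E)) ` legal_moves n \<F> E)
      | Mini \<Rightarrow> Min ((\<lambda>e. game_value n H \<F> (opponent p) (insert e E)) ` legal_moves n \<F> E))"
  by pat_completeness auto
termination
  by (relation "measure (\<lambda>(n, H, \<F>, p, E). card (all_edges {..<n} - E))")
     (simp_all add: card_remaining_less)

declare game_value.simps [simp del]

definition sat_score\<^sub>1 :: "nat \<Rightarrow> 'a graph \<Rightarrow> 'b graph set \<Rightarrow> nat" where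
  "sat_score\<^sub>1 n H \<F> = game_value n H \<F> Maxi {}"

definition sat_score\<^sub>2 :: "nat \<Rightarrow> 'a graph \<Rightarrow> 'b graph set \<Rightarrow> nat" where
  "sat_score\<^sub>2 n H \<F> = game_value n H \<F> Mini {}"

end

theory Submission
  imports Defs
begin

text \<open>For the lower bound, Max raises the degrees of the two ends of the first edge to about
  \<open>n / 4\<close> each. For the upper bound, Mini always extends one path from its current tip to a
  vertex of another component. Root the final tree at the start of that path, with parent map
  \<open>p\<close>. Every \<open>P\<^sub>4\<close> is then encoded by a pair \<open>(a, b)\<close> with \<open>p b = p (p a)\<close>: the path
  \<open>a, p a, p (p a), b\<close>, or, when \<open>b = p a\<close>, the path climbing three levels from \<open>a\<close>. Since \<open>p\<close>
  is injective on the vertices that Mini attached, the pairs involving such a vertex number at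
  most \<open>2 n\<close>. In all other pairs \<open>a\<close> and \<open>b\<close> lie at levels of different parity among at most
  \<open>n / 2\<close> vertices, which leaves at most \<open>(n / 4)\<^sup>2\<close> of them.\<close>

section \<open>Connectivity and acyclicity\<close>

text \<open>As a relation, the edge set gets connectivity from its reflexive transitive closure and
  distances from its relational powers.\<close>

definition adj :: "'a set set \<Rightarrow> 'a rel" where
  "adj E = {(x, y). {x, y} \<in> E}"

lemma sym_conn: "sym ((adj E)\<^sup>*)"
  by (intro sym_rtrancl symI) (simp add: adj_def insert_commute)

lemma conn_commute: "(x, y) \<in> (adj E)\<^sup>* \<longleftrightarrow> (y, x) \<in> (adj E)\<^sup>*"
  using sym_conn by (metis symD)

lemma conn_edge: "{x, y} \<in> E \<Longrightarrow> (x, y) \<in> (adj E)\<^sup>*"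
  by (auto simp: adj_def)

text \<open>A walk of least length repeats no vertex: cutting out the stretch between two equal
  vertices would shorten it.\<close>

lemma obtain_injective_path:
  assumes "(x, y) \<in> R\<^sup>*"
  obtains k f where "f 0 = x" "f k = y" "\<And>i. i < k \<Longrightarrow> (f i, f (Suc i)) \<in> R"
    "inj_on f {..k::nat}"
proof -
  define k where "k = (LEAST k. (x, y) \<in> R ^^ k)"
  have "(x, y) \<in> R ^^ k"
    unfolding k_def using assms by (metis LeastI rtrancl_imp_relpow)
  then obtain f where f: "f 0 = x" "f k = y" "\<And>i. i < k \<Longrightarrow> (f i, f (Suc i)) \<in> R"
    by (auto simp: relpow_fun_conv)
  have no: "f i \<noteq> f j" if "i < j" "j \<le> k" for i j
  proof
    assume eq: "f i = f j"
    have "(x, f i) \<in> R ^^ i"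
      using f that by (auto simp: relpow_fun_conv intro!: exI[of _ f])
    moreover have "(f j, y) \<in> R ^^ (k - j)"
      using f that by (auto simp: relpow_fun_conv intro!: exI[of _ "\<lambda>i. f (j + i)"])
    ultimately have "(x, y) \<in> R ^^ (i + (k - j))"
      using eq by (auto simp: relpow_add)
    then have "k \<le> i + (k - j)"
      unfolding k_def by (rule Least_le)
    then show False using that by simp
  qed
  have "inj_on f {..k}"
    by (rule inj_onI) (metis atMost_iff linorder_neqE_nat no)
  then show thesis using that f by blast
qed

text \<open>A simple path in \<open>F\<close> from \<open>u\<close> to \<open>v\<close> closes with
  the edge \<open>{u, v}\<close> to a cycle. Keeping \<open>F\<close> separate from \<open>E\<close>
  serves three uses: all edges before a move, the parent edges of a tree, and the two remaining
  sides of a triangle.\<close>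

lemma free_of_cyclesD:
  assumes free: "free_of cycles (V, E)" and E: "E \<subseteq> all_edges V"
    and F: "F \<subseteq> E" and uv: "{u, v} \<in> E" "{u, v} \<notin> F"
  shows "(u, v) \<notin> (adj F)\<^sup>*"
proof
  assume "(u, v) \<in> (adj F)\<^sup>*"
  then obtain k f where f: "f 0 = u" "f k = v" "\<And>i. i < k \<Longrightarrow> (f i, f (Suc i)) \<in> adj F"
    "inj_on f {..k::nat}"
    by (rule obtain_injective_path) blast
  \<comment> \<open>Length 0 would give \<open>u = v\<close>, and length 1 would put
    \<open>{u, v}\<close> into \<open>F\<close>. Hence the closed path has at least three
    vertices.\<close>
  have "u \<noteq> v" using uv E by (auto simp: all_edges_def)
  then have "k \<noteq> 0" using f by (metis)
  moreover have "k \<noteq> 1" using f(1,2,3) uv by (auto simp: adj_def)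
  ultimately have k: "k \<ge> 2" by simp
  have FE: "{f i, f (Suc i)} \<in> E" if "i < k" for i
    using f(3)[OF that] F by (auto simp: adj_def)
  \<comment> \<open>Index \<open>i = k\<close> wraps around to give the closing edge
    \<open>{v, u}\<close>.\<close>
  define es where "es = {{f i, f ((i + 1) mod Suc k)} | i. i < Suc k}"
  have esE: "es \<subseteq> E"
  proof
    fix e assume "e \<in> es"
    then obtain i where i: "i < Suc k" "e = {f i, f ((i + 1) mod Suc k)}"
      by (auto simp: es_def)
    show "e \<in> E"
    proof (cases "i = k")
      case True
      then show ?thesis using i uv f by (simp add: insert_commute)
    next
      case False
      then show ?thesis using i FE[of i] by simp
    qed
  qed
  define S where "S = (f ` {..<Suc k}, es)"
  have card2: "card e = 2" and eV: "e \<subseteq> V" if "e \<in> es" for e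
    using esE E that by (auto simp: all_edges_def)
  have in_verts: "e \<subseteq> f ` {..<Suc k}" if "e \<in> es" for e
    using that by (auto simp: es_def)
  have "f i \<in> V" if "i < Suc k" for i
  proof -
    have "{f i, f ((i + 1) mod Suc k)} \<in> es" using that by (auto simp: es_def)
    then show ?thesis using eV by blast
  qed
  then have sub: "is_subgraph S (V, E)"
    using esE card2 in_verts unfolding is_subgraph_def S_def all_edges_def by simp blast
  have inj: "inj_on f {..<Suc k}" using f(4) by (simp add: lessThan_Suc_atMost)
  let ?g = "inv_into {..<Suc k} f"
  have g: "?g (f i) = i" if "i < Suc k" for i
    using inv_into_f_f[OF inj] that by simp
  have "bij_betw ?g (verts S) (verts (cycle_graph (Suc k)))"
    using inj by (simp add: S_def cycle_graph_def bij_betw_inv_into inj_on_imp_bij_betw)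
  moreover have "(\<lambda>e. ?g ` e) ` edges S = edges (cycle_graph (Suc k))"
  proof -
    have "?g ` {f i, f ((i + 1) mod Suc k)} = {i, (i + 1) mod Suc k}" if "i < Suc k" for i
      using that g[of i] g[of "(i + 1) mod Suc k"] by simp
    moreover have "edges S = (\<lambda>i. {f i, f ((i + 1) mod Suc k)}) ` {..<Suc k}"
      "edges (cycle_graph (Suc k)) = (\<lambda>i. {i, (i + 1) mod Suc k}) ` {..<Suc k}"
      by (auto simp: S_def es_def cycle_graph_def)
    ultimately show ?thesis by (simp add: image_image)
  qed
  ultimately have "S \<in> copies (cycle_graph (Suc k)) (V, E)"
    using sub unfolding copies_def isomorphic_def by blast
  moreover have "cycle_graph (Suc k) \<in> cycles"
    using k by (auto simp: cycles_def intro!: exI[of _ "Suc k"])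
  ultimately show False using free by (auto simp: free_of_def)
qed

text \<open>A new cycle must use \<open>{u, v}\<close>; its other edges would then already join
  \<open>u\<close> to \<open>v\<close> in \<open>E\<close>.\<close>

lemma free_of_cycles_insert:
  assumes free: "free_of cycles (V, E)" and nc: "(u, v) \<notin> (adj E)\<^sup>*"
  shows "free_of cycles (V, insert {u, v} E)"
  unfolding free_of_def
proof (intro ballI equals0I)
  fix C S assume "C \<in> cycles" and S: "S \<in> copies C (V, insert {u, v} E)"
  then obtain k where k: "k \<ge> 3" and C: "C = cycle_graph k" by (auto simp: cycles_def)
  obtain f where f: "bij_betw f (verts S) {..<k}"
    "(\<lambda>e. f ` e) ` edges S = {{i, (i + 1) mod k} | i. i < k}"
    using S by (auto simp: copies_def isomorphic_def C cycle_graph_def)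
  have sub: "verts S \<subseteq> V" "edges S \<subseteq> insert {u, v} E" "edges S \<subseteq> all_edges (verts S)"
    using S by (auto simp: copies_def is_subgraph_def)
  define g where "g = inv_into (verts S) f"
  have gf: "g ` f ` e = e" if "e \<in> edges S" for e
    unfolding g_def using sub(3) that f(1)
    by (intro inv_into_image_cancel) (auto simp: all_edges_def bij_betw_def)
  have inj_g: "inj_on g {..<k}"
    using bij_betw_inv_into[OF f(1)] by (auto simp: g_def bij_betw_def)
  have cyc: "{{i, (i + 1) mod k} | i. i < k} = (\<lambda>i. {i, (i + 1) mod k}) ` {..<k}" by auto
  have edgesS: "edges S = (\<lambda>i. {g i, g ((i + 1) mod k)}) ` {..<k}"
  proof -
    have "edges S = (\<lambda>e. g ` e) ` (\<lambda>e. f ` e) ` edges S"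
      using gf by (force simp: image_image)
    also have "\<dots> = (\<lambda>e. g ` e) ` (\<lambda>i. {i, (i + 1) mod k}) ` {..<k}"
      by (simp only: f(2) cyc)
    finally show ?thesis by (simp add: image_image)
  qed
  show False
  proof (cases "edges S \<subseteq> E")
    case True
    then have "S \<in> copies C (V, E)" using S by (auto simp: copies_def is_subgraph_def)
    then show False using free \<open>C \<in> cycles\<close> by (auto simp: free_of_def)
  next
    case False
    then have "{u, v} \<in> edges S" using sub(2) by blast
    then obtain i where i: "i < k" "{u, v} = {g i, g ((i + 1) mod k)}"
      using edgesS by auto
    have step: "{g m, g ((m + 1) mod k)} \<in> E" if m: "m < k" "m \<noteq> i" for m
    proof -
      \<comment> \<open>Since \<open>k \<ge> 3\<close>, different indices give different edges of
        the cycle, so only index \<open>i\<close> yields \<open>{u, v}\<close>.\<close>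
      have "{m, (m + 1) mod k} \<noteq> {i, (i + 1) mod k}"
        using m i(1) k by (auto simp: doubleton_eq_iff mod_Suc split: if_splits)
      moreover have "{m, (m + 1) mod k} \<subseteq> {..<k}" "{i, (i + 1) mod k} \<subseteq> {..<k}"
        using m i(1) by auto
      ultimately have "g ` {m, (m + 1) mod k} \<noteq> g ` {i, (i + 1) mod k}"
        using inj_g by (meson inj_on_image_eq_iff)
      then have "{g m, g ((m + 1) mod k)} \<noteq> {u, v}" using i(2) by simp
      then show ?thesis using edgesS sub(2) m by auto
    qed
    \<comment> \<open>Walk around the cycle, starting just past the new edge. Its index
      \<open>i\<close> recurs only after \<open>k - 1\<close> steps, so that many steps stay in
      \<open>E\<close> and end at \<open>g i\<close>.\<close>
    have "(g ((i + 1) mod k), g ((i + 1 + j) mod k)) \<in> (adj E)\<^sup>*" if "j < k" for j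
      using that
    proof (induction j)
      case (Suc j)
      have "(i + 1 + j) mod k \<noteq> i"
      proof
        assume "(i + 1 + j) mod k = i"
        then have "k dvd (i + 1 + j) - i" by (metis minus_mod_eq_div_mult dvd_triv_right)
        then show False using Suc.prems by (auto dest: dvd_imp_le)
      qed
      then have "{g ((i + 1 + j) mod k), g (((i + 1 + j) mod k + 1) mod k)} \<in> E"
        using step[of "(i + 1 + j) mod k"] k by simp
      then have "(g ((i + 1 + j) mod k), g ((i + 1 + Suc j) mod k)) \<in> adj E"
        by (simp add: adj_def mod_simps)
      then show ?case using Suc by (meson Suc_lessD rtrancl.rtrancl_into_rtrancl)
    qed simp
    from this[of "k - 1"] have "(g ((i + 1) mod k), g i) \<in> (adj E)\<^sup>*"
      using k i(1) by simp
    then show False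
      using nc i(2) conn_commute[of u v E] by (auto simp: doubleton_eq_iff)
  qed
qed

lemma free_of_cycles_empty: "free_of cycles (V, {})"
proof -
  have nonempty: "edges (cycle_graph k) \<noteq> {}" if "k \<ge> 3" for k
    using that by (auto simp: cycle_graph_def intro: exI[of _ 0])
  have "copies (cycle_graph k) (V, {}) = {}" if "k \<ge> 3" for k
    using nonempty[OF that] by (fastforce simp: copies_def is_subgraph_def isomorphic_def)
  then show ?thesis by (auto simp: free_of_def cycles_def)
qed

text \<open>Let \<open>l\<close> be the distance from \<open>r\<close>, and let \<open>p\<close>
  choose a neighbour one step closer. The parent edges alone connect \<open>V\<close>, so any
  further edge would close a cycle.\<close>

lemma rooted_tree:
  assumes free: "free_of cycles (V, E)" and E: "E \<subseteq> all_edges V"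
    and r: "r \<in> V" and conn: "\<And>v. v \<in> V \<Longrightarrow> (r, v) \<in> (adj E)\<^sup>*"
  obtains p and l :: "'a \<Rightarrow> nat"
  where "\<And>v. v \<in> V - {r} \<Longrightarrow> p v \<in> V" "\<And>v. v \<in> V - {r} \<Longrightarrow> l v = Suc (l (p v))"
    "E = (\<lambda>v. {v, p v}) ` (V - {r})" "card E = card (V - {r})"
proof -
  define l where "l v = (LEAST k. (r, v) \<in> adj E ^^ k)" for v
  have l: "(r, v) \<in> adj E ^^ l v" if "v \<in> V" for v
    unfolding l_def using conn[OF that] by (metis LeastI rtrancl_imp_relpow)
  have l_le: "l v \<le> k" if "(r, v) \<in> adj E ^^ k" for v k
    unfolding l_def using that by (rule Least_le)
  have "\<exists>u. u \<in> V \<and> {v, u} \<in> E \<and> l v = Suc (l u)" if v: "v \<in> V - {r}" for v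
  proof -
    obtain k where k: "l v = Suc k"
      using l[of v] v by (cases "l v") auto
    then obtain u where u: "(r, u) \<in> adj E ^^ k" "(u, v) \<in> adj E"
      using l[of v] v by auto
    have "{v, u} \<in> E" using u by (simp add: adj_def insert_commute)
    moreover from this have uV: "u \<in> V" using E by (auto simp: all_edges_def)
    \<comment> \<open>Minimality is used twice: \<open>l v\<close> is at most
      \<open>Suc (l u)\<close>, and \<open>l u\<close> is at most \<open>k\<close>.\<close>
    moreover have "(r, v) \<in> adj E ^^ Suc (l u)" using l[OF uV] u by auto
    then have "l v = Suc (l u)" using l_le[of v "Suc (l u)"] l_le[OF u(1)] k by simp
    ultimately show ?thesis by blast
  qed
  then obtain p where p: "\<And>v. v \<in> V - {r} \<Longrightarrow> p v \<in> V"
    "\<And>v. v \<in> V - {r} \<Longrightarrow> {v, p v} \<in> E" "\<And>v. v \<in> V - {r} \<Longrightarrow> l v = Suc (l (p v))"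
    by metis
  define F where "F = (\<lambda>v. {v, p v}) ` (V - {r})"
  have FE: "F \<subseteq> E" using p by (auto simp: F_def)
  have connF: "(r, v) \<in> (adj F)\<^sup>*" if "v \<in> V" for v
    using that
  proof (induction "l v" arbitrary: v rule: less_induct)
    case less
    show ?case
    proof (cases "v = r")
      case False
      then have "(r, p v) \<in> (adj F)\<^sup>*" using less p by (metis Diff_iff lessI singletonD)
      moreover have "(p v, v) \<in> adj F" using less False by (auto simp: adj_def F_def)
      ultimately show ?thesis by (rule rtrancl_into_rtrancl)
    qed simp
  qed
  have "e \<in> F" if e: "e \<in> E" for e
  proof (rule ccontr)
    assume "e \<notin> F"
    obtain u v where uv: "e = {u, v}" "u \<in> V" "v \<in> V"
      using e E by (auto simp: all_edges_def card_2_iff)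
    have "(u, v) \<in> (adj F)\<^sup>*"
      using connF uv(2,3) by (meson conn_commute rtrancl_trans)
    then show False using free_of_cyclesD[OF free E FE] e \<open>e \<notin> F\<close> uv by blast
  qed
  then have "E = F" using FE by blast
  \<comment> \<open>Two vertices with the same parent edge would be each other's parents, and each
    would lie one level above the other.\<close>
  moreover have "inj_on (\<lambda>v. {v, p v}) (V - {r})"
  proof (rule inj_onI, rule ccontr)
    fix v w assume *: "v \<in> V - {r}" "w \<in> V - {r}" "{v, p v} = {w, p w}" "v \<noteq> w"
    then have "v = p w" "w = p v" by (auto simp: doubleton_eq_iff)
    then show False using p(3)[of v] p(3)[of w] * by simp
  qed
  then have "card F = card (V - {r})" unfolding F_def by (rule card_image)
  ultimately show thesis using that p F_def by blast
qed

section \<open>Copies of the path on four vertices\<close>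

text \<open>A pair of sets rather than a vertex sequence, so that a path and its reversal count
  once, as in \<open>copies\<close>.\<close>

definition path4 :: "'a \<Rightarrow> 'a \<Rightarrow> 'a \<Rightarrow> 'a \<Rightarrow> 'a graph" where
  "path4 a b c d = ({a, b, c, d}, {{a, b}, {b, c}, {c, d}})"

lemma path4_rev: "path4 a b c d = path4 d c b a"
  by (auto simp: path4_def)

lemma path_graph_4: "path_graph 4 = path4 0 1 2 3"
proof -
  have "{..<4} = {0, 1, 2, 3 :: nat}" by auto
  moreover have "{{i, i + 1} | i. i + 1 < (4 :: nat)} = (\<lambda>i. {i, i + 1}) ` {0, 1, 2}"
    by (auto simp: Setcompr_eq_image intro!: image_eqI)
  ultimately show ?thesis by (simp add: path_graph_def path4_def numeral_eq_Suc)
qed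

lemma path4_in_copies:
  assumes "distinct [a, b, c, d]" "{a, b, c, d} \<subseteq> V" "{{a, b}, {b, c}, {c, d}} \<subseteq> E"
  shows "path4 a b c d \<in> copies (path_graph 4) (V, E)"
proof -
  define f :: "'a \<Rightarrow> nat" where
    "f x = (if x = a then 0 else if x = b then 1 else if x = c then 2 else 3)" for x
  have f: "f a = 0" "f b = 1" "f c = 2" "f d = 3"
    using assms(1) by (auto simp: f_def)
  have "bij_betw f {a, b, c, d} {0, 1, 2, 3}"
    using f by (auto simp: bij_betw_def inj_on_def)
  moreover have "(\<lambda>e. f ` e) ` {{a, b}, {b, c}, {c, d}} = {{0, 1}, {1, 2}, {2, 3}}"
    using f by simp
  ultimately have "isomorphic (path4 a b c d) (path_graph 4)"
    unfolding isomorphic_def path_graph_4 path4_def fst_conv snd_conv by blast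
  moreover have "is_subgraph (path4 a b c d) (V, E)"
    using assms unfolding is_subgraph_def path4_def all_edges_def by simp
  ultimately show ?thesis by (simp add: copies_def)
qed

lemma copies_path4E:
  assumes "S \<in> copies (path_graph 4) (V, E)"
  obtains a b c d where "S = path4 a b c d" "distinct [a, b, c, d]"
    "{a, b} \<in> E" "{b, c} \<in> E" "{c, d} \<in> E"
proof -
  obtain f where f: "bij_betw f (verts S) {0, 1, 2, 3 :: nat}"
    "(\<lambda>e. f ` e) ` edges S = {{0, 1}, {1, 2}, {2, 3}}"
    using assms by (auto simp: copies_def isomorphic_def path_graph_4 path4_def)
  have sub: "edges S \<subseteq> E" "edges S \<subseteq> all_edges (verts S)"
    using assms by (auto simp: copies_def is_subgraph_def)
  define g where "g = inv_into (verts S) f"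
  have g: "bij_betw g {0, 1, 2, 3} (verts S)"
    using bij_betw_inv_into[OF f(1)] by (simp add: g_def)
  have gf: "g ` f ` e = e" if "e \<in> edges S" for e
    unfolding g_def using sub(2) that f(1)
    by (intro inv_into_image_cancel) (auto simp: all_edges_def bij_betw_def)
  have "edges S = (\<lambda>e. g ` e) ` (\<lambda>e. f ` e) ` edges S"
    using gf by (force simp: image_image)
  then have es: "edges S = {{g 0, g 1}, {g 1, g 2}, {g 2, g 3}}"
    by (simp add: f(2))
  moreover have "verts S = {g 0, g 1, g 2, g 3}"
    using g by (auto simp: bij_betw_def)
  ultimately have "S = path4 (g 0) (g 1) (g 2) (g 3)"
    by (simp add: path4_def prod_eq_iff)
  moreover have "distinct [g 0, g 1, g 2, g 3]"
    using g by (auto simp: bij_betw_def inj_on_def)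
  ultimately show thesis using that es sub(1) by auto
qed

section \<open>Strategies\<close>

lemma finite_legal_moves: "finite (legal_moves n \<F> E)"
  by (rule finite_subset[OF _ finite_all_edges[of "{..<n}"]]) (auto simp: legal_moves_def)

text \<open>A strategy for Mini is given as an invariant \<open>I\<close>: every move of Max must
  preserve it, while for Mini one preserving reply is enough. The score bound is checked only in
  final positions.\<close>

lemma game_value_le:
  assumes over: "\<And>p E. I p E \<Longrightarrow> legal_moves n \<F> E = {} \<Longrightarrow> card (copies H ({..<n}, E)) \<le> K"
    and maxi: "\<And>E e. I Maxi E \<Longrightarrow> e \<in> legal_moves n \<F> E \<Longrightarrow> I Mini (insert e E)"
    and mini: "\<And>E. I Mini E \<Longrightarrow> legal_moves n \<F> E \<noteq> {} \<Longrightarrow>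
      \<exists>e\<in>legal_moves n \<F> E. I Maxi (insert e E)"
    and "I p E"
  shows "game_value n H \<F> p E \<le> K"
  using \<open>I p E\<close>
proof (induction "card (all_edges {..<n} - E)" arbitrary: p E rule: less_induct)
  case less
  note IH = less.hyps[OF card_remaining_less]
  show ?case
  proof (cases "legal_moves n \<F> E = {}")
    case True
    then show ?thesis using over less.prems by (simp add: game_value.simps[of n H \<F>])
  next
    case False
    show ?thesis
    proof (cases p)
      case Maxi
      have "game_value n H \<F> Mini (insert e E) \<le> K" if "e \<in> legal_moves n \<F> E" for e
        using IH[OF that] maxi[OF _ that] less.prems Maxi by blast
      then show ?thesis using False Maxi finite_legal_moves[of n \<F> E]
        by (subst game_value.simps) simp
    next
      case Mini
      then obtain e where "e \<in> legal_moves n \<F> E" "I Maxi (insert e E)"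
        using mini False less.prems by blast
      then show ?thesis using IH Mini finite_legal_moves[of n \<F> E]
        by (subst game_value.simps) (auto simp: Min_le_iff)
    qed
  qed
qed

text \<open>The dual principle, with \<open>I\<close> as an invariant that Max can maintain.\<close>

lemma game_value_ge:
  assumes over: "\<And>p E. I p E \<Longrightarrow> legal_moves n \<F> E = {} \<Longrightarrow> K \<le> card (copies H ({..<n}, E))"
    and mini: "\<And>E e. I Mini E \<Longrightarrow> e \<in> legal_moves n \<F> E \<Longrightarrow> I Maxi (insert e E)"
    and maxi: "\<And>E. I Maxi E \<Longrightarrow> legal_moves n \<F> E \<noteq> {} \<Longrightarrow>
      \<exists>e\<in>legal_moves n \<F> E. I Mini (insert e E)"
    and "I p E"
  shows "K \<le> game_value n H \<F> p E"
  using \<open>I p E\<close>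
proof (induction "card (all_edges {..<n} - E)" arbitrary: p E rule: less_induct)
  case less
  note IH = less.hyps[OF card_remaining_less]
  show ?case
  proof (cases "legal_moves n \<F> E = {}")
    case True
    then show ?thesis using over less.prems by (simp add: game_value.simps[of n H \<F>])
  next
    case False
    show ?thesis
    proof (cases p)
      case Mini
      have "K \<le> game_value n H \<F> Maxi (insert e E)" if "e \<in> legal_moves n \<F> E" for e
        using IH[OF that] mini[OF _ that] less.prems Mini by blast
      then show ?thesis using False Mini finite_legal_moves[of n \<F> E]
        by (subst game_value.simps) simp
    next
      case Maxi
      then obtain e where "e \<in> legal_moves n \<F> E" "I Mini (insert e E)"
        using maxi False less.prems by blast
      then show ?thesis using IH Maxi finite_legal_moves[of n \<F> E]
        by (subst game_value.simps) (auto simp: Max_ge_iff)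
    qed
  qed
qed

section \<open>Positions and legal moves of the cycle-free game\<close>

definition forest :: "nat \<Rightarrow> nat set set \<Rightarrow> bool" where
  "forest n E \<longleftrightarrow> E \<subseteq> all_edges {..<n} \<and> free_of cycles ({..<n}, E)"

lemma forest_empty: "forest n {}"
  by (simp add: forest_def free_of_cycles_empty)

lemma forest_insert: "forest n E \<Longrightarrow> e \<in> legal_moves n cycles E \<Longrightarrow> forest n (insert e E)"
  by (auto simp: forest_def legal_moves_def)

lemma finite_forest: "forest n E \<Longrightarrow> finite E"
  by (meson finite_all_edges finite_lessThan finite_subset forest_def)

text \<open>Legality becomes a question of components. The right-hand side also rules out loops and
  claimed edges, because their ends are connected.\<close>

lemma legal_moves_cycles_iff:
  assumes "forest n E"
  shows "{u, v} \<in> legal_moves n cycles E \<longleftrightarrow> u < n \<and> v < n \<and> (u, v) \<notin> (adj E)\<^sup>*"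
proof
  assume "{u, v} \<in> legal_moves n cycles E"
  then have *: "{u, v} \<in> all_edges {..<n}" "{u, v} \<notin> E"
    "free_of cycles ({..<n}, insert {u, v} E)" by (auto simp: legal_moves_def)
  then have "(u, v) \<notin> (adj E)\<^sup>*"
    using assms by (intro free_of_cyclesD[OF *(3)]) (auto simp: forest_def)
  then show "u < n \<and> v < n \<and> (u, v) \<notin> (adj E)\<^sup>*" using * by (auto simp: all_edges_def)
next
  assume *: "u < n \<and> v < n \<and> (u, v) \<notin> (adj E)\<^sup>*"
  then have "u \<noteq> v" "{u, v} \<notin> E" using conn_edge[of u v E] by auto
  then show "{u, v} \<in> legal_moves n cycles E"
    using * assms free_of_cycles_insert
    by (auto simp: legal_moves_def all_edges_def forest_def)
qed

text \<open>The ends of a legal edge lie in different components, so \<open>u\<close> is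
  disconnected from at least one of them. Thus a player can always move at a vertex of choice until
  the game ends.\<close>

lemma ex_legal_move_from:
  assumes "forest n E" "legal_moves n cycles E \<noteq> {}" "u < n"
  shows "\<exists>w. {u, w} \<in> legal_moves n cycles E"
proof -
  obtain e where e: "e \<in> legal_moves n cycles E" using assms(2) by blast
  then have "card e = 2" by (simp add: legal_moves_def all_edges_def)
  then obtain x y where xy: "e = {x, y}" by (meson card_2_iff)
  then have *: "x < n" "y < n" "(x, y) \<notin> (adj E)\<^sup>*"
    using e legal_moves_cycles_iff[OF assms(1), of x y] by simp_all
  then have "(u, x) \<notin> (adj E)\<^sup>* \<or> (u, y) \<notin> (adj E)\<^sup>*"
    by (meson conn_commute rtrancl_trans)
  then show ?thesis
    using * assms(3) legal_moves_cycles_iff[OF assms(1), of u x]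
      legal_moves_cycles_iff[OF assms(1), of u y] by blast
qed

text \<open>Without legal moves all vertices are connected, so any vertex may serve as root. The
  edge count fixes the length of the game.\<close>

lemma final_tree:
  assumes "forest n E" "legal_moves n cycles E = {}" "r < n"
  obtains p and l :: "nat \<Rightarrow> nat"
  where "\<And>v. v \<in> {..<n} - {r} \<Longrightarrow> p v < n" "\<And>v. v \<in> {..<n} - {r} \<Longrightarrow> l v = Suc (l (p v))"
    "E = (\<lambda>v. {v, p v}) ` ({..<n} - {r})" "card E = n - 1"
proof -
  have "(r, v) \<in> (adj E)\<^sup>*" if "v < n" for v
    using legal_moves_cycles_iff[OF assms(1), of r v] assms(2,3) that by simp
  moreover have "free_of cycles ({..<n}, E)" "E \<subseteq> all_edges {..<n}"
    using assms(1) by (simp_all add: forest_def)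
  moreover have "card ({..<n} - {r}) = n - 1" using assms(3) by simp
  moreover have "r \<in> {..<n}" using assms(3) by simp
  ultimately show thesis
    using that rooted_tree[of "{..<n}" E r thesis] unfolding lessThan_iff by presburger
qed

section \<open>The upper bound\<close>

text \<open>Direct the middle edge of a path towards the root. The end next to its lower vertex must
  be a child of that vertex; the end next to its upper vertex is either the parent or another child
  of it. It suffices that the decoding \<open>h\<close> hits every copy.\<close>

lemma card_copies_path4_le:
  assumes "finite N" and l: "\<And>v. v \<in> N \<Longrightarrow> l v = Suc (l (p v) :: nat)"
    and E: "E = (\<lambda>v. {v, p v}) ` N"
  shows "card (copies (path_graph 4) (V, E))
    \<le> card {(a, b). a \<in> N \<and> b \<in> N \<and> p a \<in> N \<and> p b = p (p a)}" (is "_ \<le> card ?Q")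
proof -
  \<comment> \<open>A child of \<open>p (p a)\<close> serving as the fourth vertex differs from
    \<open>p a\<close>, so the value \<open>b = p a\<close> is free to encode the climbing
    path.\<close>
  define h where
    "h = (\<lambda>(a, b). path4 a (p a) (p (p a)) (if b = p a then p (p (p a)) else b))"
  have edge: "(x \<in> N \<and> p x = y) \<or> (y \<in> N \<and> p y = x)" if "{x, y} \<in> E" for x y
    using that E by (auto simp: doubleton_eq_iff)
  have down: "path4 a b c d \<in> h ` ?Q"
    if "distinct [a, b, c, d]" "{a, b} \<in> E" "{c, d} \<in> E" "b \<in> N" "p b = c" for a b c d
  proof -
    have a: "a \<in> N" "p a = b" using edge[OF that(2)] that by auto
    from edge[OF that(3)] show ?thesis
    proof
      assume "c \<in> N \<and> p c = d"
      then show ?thesis using a that by (intro image_eqI[of _ _ "(a, b)"]) (auto simp: h_def)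
    next
      assume "d \<in> N \<and> p d = c"
      then show ?thesis using a that by (intro image_eqI[of _ _ "(a, d)"]) (auto simp: h_def)
    qed
  qed
  have "copies (path_graph 4) (V, E) \<subseteq> h ` ?Q"
  proof
    fix S assume "S \<in> copies (path_graph 4) (V, E)"
    then obtain a b c d where S: "S = path4 a b c d" "distinct [a, b, c, d]"
      "{a, b} \<in> E" "{b, c} \<in> E" "{c, d} \<in> E" by (rule copies_path4E)
    from edge[OF S(4)] show "S \<in> h ` ?Q"
    proof
      assume "b \<in> N \<and> p b = c"
      then show ?thesis using down S by blast
    next
      assume "c \<in> N \<and> p c = b"
      then have "path4 d c b a \<in> h ` ?Q"
        using S by (intro down) (auto simp: insert_commute)
      then show ?thesis using S(1) path4_rev by metis
    qed
  qed
  moreover have "finite ?Q" by (rule finite_subset[of _ "N \<times> N"]) (use assms in auto)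
  ultimately show ?thesis by (meson card_image_le card_mono finite_imageI le_trans)
qed

text \<open>Here \<open>W\<close> plays the role of the long path below the root. Pairs meeting
  \<open>W\<close> are determined by one coordinate, and the others join even levels to odd ones
  outside \<open>W\<close>.\<close>

lemma card_cousins_le:
  assumes fin: "finite N" and l: "\<And>v. v \<in> N \<Longrightarrow> l v = Suc (l (p v) :: nat)"
    and W: "W \<subseteq> N" "inj_on p W" "\<And>a. a \<in> W \<Longrightarrow> p a \<in> N \<Longrightarrow> p a \<in> W"
  shows "4 * card {(a, b). a \<in> N \<and> b \<in> N \<and> p a \<in> N \<and> p b = p (p a)}
    \<le> (card (N - W))\<^sup>2 + 8 * card N" (is "4 * card ?Q \<le> _")
proof -
  define Q where "Q = ?Q"
  have finQ: "finite Q"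
    unfolding Q_def by (rule finite_subset[of _ "N \<times> N"]) (use fin in auto)
  \<comment> \<open>From \<open>b\<close> one knows \<open>p (p a) = p b\<close>. As
    \<open>p a\<close> is again in \<open>W\<close>, injectivity of \<open>p\<close> on
    \<open>W\<close> applied twice recovers \<open>a\<close>.\<close>
  have "inj_on snd (Q \<inter> {(a, b). a \<in> W})"
    using W(2,3) by (auto simp: inj_on_def Q_def)
  then have Q2: "card (Q \<inter> {(a, b). a \<in> W}) \<le> card N"
    by (rule card_inj_on_le) (use fin in \<open>auto simp: Q_def\<close>)
  \<comment> \<open>Now \<open>a\<close> fixes \<open>p b\<close>, and hence
    \<open>b\<close>.\<close>
  have "inj_on fst (Q \<inter> {(a, b). b \<in> W})"
    using W(2) by (auto simp: inj_on_def Q_def)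
  then have Q3: "card (Q \<inter> {(a, b). b \<in> W}) \<le> card N"
    by (rule card_inj_on_le) (use fin in \<open>auto simp: Q_def\<close>)
  define M where "M = N - W"
  define M0 where "M0 = {v \<in> M. even (l v)}"
  define M1 where "M1 = {v \<in> M. odd (l v)}"
  have finM: "finite M0" "finite M1" using fin by (auto simp: M_def M0_def M1_def)
  \<comment> \<open>The vertices \<open>b\<close> and \<open>p a\<close> have the same parent and so
    the same level.\<close>
  have level: "l a = Suc (l b)" if "(a, b) \<in> Q" for a b
    using that l[of a] l[of b] l[of "p a"] by (auto simp: Q_def)
  \<comment> \<open>Puts the vertex of even level first. Since \<open>a\<close> is the deeper of the
    two, the original order can be recovered.\<close>
  define s where "s = (\<lambda>(a, b). if even (l a) then (a, b) else (b, a))"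
  have "inj_on s (Q \<inter> M \<times> M)"
  proof (rule inj_onI)
    fix x y assume *: "x \<in> Q \<inter> M \<times> M" "y \<in> Q \<inter> M \<times> M" "s x = s y"
    show "x = y"
      using * level[of "fst x" "snd x"] level[of "fst y" "snd y"]
      by (cases x; cases y) (auto simp: s_def split: if_splits)
  qed
  moreover have "s ` (Q \<inter> M \<times> M) \<subseteq> M0 \<times> M1"
    using level by (auto simp: s_def M0_def M1_def split: if_splits)
  ultimately have Q1: "card (Q \<inter> M \<times> M) \<le> card M0 * card M1"
    using finM by (metis card_cartesian_product card_inj_on_le finite_cartesian_product)
  have "M = M0 \<union> M1" "M0 \<inter> M1 = {}" by (auto simp: M0_def M1_def)
  then have M: "card M = card M0 + card M1" using finM card_Un_disjoint by blast
  have "4 * (x * y) \<le> (x + y)\<^sup>2" for x y :: nat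
  proof -
    have "4 * (int x * int y) \<le> (int x + int y)\<^sup>2"
      using zero_le_power2[of "int x - int y"] by (simp add: power2_eq_square algebra_simps)
    then show ?thesis by (metis (mono_tags) of_nat_add of_nat_le_iff of_nat_mult of_nat_numeral of_nat_power)
  qed
  then have "4 * card (Q \<inter> M \<times> M) \<le> (card M)\<^sup>2"
    using Q1 M by (metis le_trans mult_le_mono2)
  moreover have "Q \<subseteq> (Q \<inter> M \<times> M) \<union> (Q \<inter> {(a, b). a \<in> W}) \<union> (Q \<inter> {(a, b). b \<in> W})"
    by (auto simp: Q_def M_def)
  then have "card Q \<le> card (Q \<inter> M \<times> M) + card (Q \<inter> {(a, b). a \<in> W})
      + card (Q \<inter> {(a, b). b \<in> W})"
    using finQ by (smt (verit) card_Un_le card_mono finite_Int finite_UnI le_trans add_le_mono1)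
  ultimately show ?thesis using Q2 Q3 unfolding Q_def M_def by linarith
qed

text \<open>Rooting the tree at the start of the path \<open>ts\<close> makes every later vertex of
  \<open>ts\<close> the child of its predecessor. At most half of all vertices lie off
  \<open>ts\<close>.\<close>

lemma score_le:
  assumes E: "forest n E" "legal_moves n cycles E = {}"
    and ts: "ts \<noteq> []" "distinct ts" "set ts \<subseteq> {..<n}"
      "\<And>i. Suc i < length ts \<Longrightarrow> {ts ! i, ts ! Suc i} \<in> E"
    and len: "n \<le> 2 * length ts"
  shows "16 * card (copies (path_graph 4) ({..<n}, E)) \<le> n\<^sup>2 + 32 * n"
proof -
  define r where "r = ts ! 0"
  have r: "r < n" using ts(1,3) nth_mem[of 0 ts] by (auto simp: r_def simp del: nth_mem)
  obtain p and l :: "nat \<Rightarrow> nat" where p: "\<And>v. v \<in> {..<n} - {r} \<Longrightarrow> p v < n"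
    "\<And>v. v \<in> {..<n} - {r} \<Longrightarrow> l v = Suc (l (p v))" "E = (\<lambda>v. {v, p v}) ` ({..<n} - {r})"
    by (rule final_tree[OF E r]) (rule that)
  define N where "N = {..<n} - {r}"
  define W where "W = set ts - {r}"
  have W_ex: "\<exists>i. Suc i < length ts \<and> x = ts ! Suc i" if "x \<in> W" for x
    using that by (auto simp: W_def r_def in_set_conv_nth) (metis not0_implies_Suc)
  \<comment> \<open>Each edge of \<open>ts\<close> is a parent edge, in one of two directions. The
    wrong one is impossible: the first vertex is the root, and later ones already have their
    predecessor as parent.\<close>
  have parent: "p (ts ! Suc i) = ts ! i" if "Suc i < length ts" for i
    using that
  proof (induction i)
    case 0
    then show ?case using ts(4)[of 0] p(3) by (auto simp: r_def doubleton_eq_iff)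
  next
    case (Suc i)
    have "ts ! i \<noteq> ts ! Suc (Suc i)" using Suc.prems ts(2) by (simp add: nth_eq_iff_index_eq)
    then show ?case using Suc ts(4)[of "Suc i"] p(3) by (auto simp: doubleton_eq_iff)
  qed
  have "inj_on p W"
  proof (rule inj_onI)
    fix x y assume *: "x \<in> W" "y \<in> W" "p x = p y"
    obtain i j where "Suc i < length ts" "x = ts ! Suc i" "Suc j < length ts" "y = ts ! Suc j"
      using W_ex *(1,2) by metis
    then show "x = y" using parent[of i] parent[of j] *(3) ts(2)
      by (simp add: nth_eq_iff_index_eq)
  qed
  moreover have "p a \<in> W" if "a \<in> W" "p a \<in> N" for a
    using W_ex[OF that(1)] parent that(2) by (auto simp: N_def W_def)
  moreover have "W \<subseteq> N" using ts(3) by (auto simp: W_def N_def)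
  moreover have "finite N" by (simp add: N_def)
  moreover have lN: "\<And>v. v \<in> N \<Longrightarrow> l v = Suc (l (p v))" using p(2) by (simp add: N_def)
  ultimately have "4 * card (copies (path_graph 4) ({..<n}, E)) \<le> (card (N - W))\<^sup>2 + 8 * card N"
    using card_cousins_le[of N l p W] card_copies_path4_le[of N l p E "{..<n}"] p(3)
    by (simp add: N_def)
  moreover have "card N \<le> n" by (simp add: N_def card_Diff_singleton_if)
  moreover have "N - W = {..<n} - set ts" using ts(1) by (auto simp: N_def W_def r_def)
  then have "2 * card (N - W) \<le> n"
    using ts(2,3) len by (simp add: card_Diff_subset distinct_card)
  then have "(2 * card (N - W))\<^sup>2 \<le> n\<^sup>2" by (rule power_mono) simp
  ultimately show ?thesis by (simp add: power_mult_distrib)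
qed

text \<open>Mini's moves all lengthen one path, which therefore grows by a vertex in every round of
  two edges.\<close>

lemma game_value_upper:
  assumes "n > 0"
  shows "16 * game_value n (path_graph 4) cycles q {} \<le> n\<^sup>2 + 32 * n"
proof -
  \<comment> \<open>The path \<open>[0]\<close> gives equality at the start if Max is to move. The
    extra 1 pays for the edge Max has just added.\<close>
  define I where "I q E \<longleftrightarrow> forest n E \<and> (\<exists>ts. ts \<noteq> [] \<and> distinct ts \<and> set ts \<subseteq> {..<n} \<and>
      (\<forall>i. Suc i < length ts \<longrightarrow> {ts ! i, ts ! Suc i} \<in> E) \<and>
      card E + 2 \<le> 2 * length ts + (if q = Mini then 1 else 0))" for q E
  have "game_value n (path_graph 4) cycles q {} \<le> (n\<^sup>2 + 32 * n) div 16"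
  proof (rule game_value_le[of I])
    fix q E assume I: "I q E" and L: "legal_moves n cycles E = {}"
    then obtain ts where ts: "forest n E" "ts \<noteq> []" "distinct ts" "set ts \<subseteq> {..<n}"
      "\<And>i. Suc i < length ts \<Longrightarrow> {ts ! i, ts ! Suc i} \<in> E" "card E + 2 \<le> 2 * length ts + 1"
      by (auto simp: I_def split: if_splits)
    \<comment> \<open>With \<open>n - 1\<close> edges, the weaker form of the invariant is exactly
      \<open>n \<le> 2 * length ts\<close>.\<close>
    have "card E = n - 1" using final_tree[OF ts(1) L assms] by blast
    then have "16 * card (copies (path_graph 4) ({..<n}, E)) \<le> n\<^sup>2 + 32 * n"
      using ts assms by (intro score_le[OF ts(1) L ts(2-5)]) simp_all
    then show "card (copies (path_graph 4) ({..<n}, E)) \<le> (n\<^sup>2 + 32 * n) div 16"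
      by (simp add: less_eq_div_iff_mult_less_eq mult.commute)
  next
    fix E e assume I: "I Maxi E" and e: "e \<in> legal_moves n cycles E"
    then obtain ts where ts: "forest n E" "ts \<noteq> []" "distinct ts" "set ts \<subseteq> {..<n}"
      "\<And>i. Suc i < length ts \<Longrightarrow> {ts ! i, ts ! Suc i} \<in> E" "card E + 2 \<le> 2 * length ts"
      by (auto simp: I_def)
    have "card (insert e E) \<le> Suc (card E)" by (rule card_insert_le_m1) auto
    then show "I Mini (insert e E)"
      unfolding I_def using forest_insert[OF ts(1) e] ts by (intro conjI exI[of _ ts]) auto
  next
    fix E assume I: "I Mini E" and L: "legal_moves n cycles E \<noteq> {}"
    then obtain ts where ts: "forest n E" "ts \<noteq> []" "distinct ts" "set ts \<subseteq> {..<n}"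
      "\<And>i. Suc i < length ts \<Longrightarrow> {ts ! i, ts ! Suc i} \<in> E" "card E + 2 \<le> 2 * length ts + 1"
      by (auto simp: I_def)
    have "last ts < n" using ts(2,4) last_in_set by blast
    then obtain w where w: "{last ts, w} \<in> legal_moves n cycles E"
      using ex_legal_move_from[OF ts(1) L] by blast
    then have w': "w < n" "(last ts, w) \<notin> (adj E)\<^sup>*"
      using legal_moves_cycles_iff[OF ts(1)] by blast+
    \<comment> \<open>The whole path lies in the component of its tip, so the new vertex
      \<open>w\<close> cannot be on it.\<close>
    have conn: "(ts ! i, ts ! (length ts - 1)) \<in> (adj E)\<^sup>*" if "i < length ts" for i
    proof -
      have "i \<le> length ts - 1" using that by simp
      then show ?thesis
      proof (induction i rule: inc_induct)
        case (step m)
        then have "(ts ! m, ts ! Suc m) \<in> adj E" using ts(5)[of m] by (simp add: adj_def)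
        then show ?case using step by (meson converse_rtrancl_into_rtrancl)
      qed simp
    qed
    have "w \<notin> set ts"
      using conn w'(2) conn_commute[of w] ts(2) by (auto simp: in_set_conv_nth last_conv_nth)
    moreover have "card (insert {last ts, w} E) \<le> Suc (card E)"
      by (rule card_insert_le_m1) auto
    moreover have "{(ts @ [w]) ! i, (ts @ [w]) ! Suc i} \<in> insert {last ts, w} E"
      if "Suc i < length (ts @ [w])" for i
    proof (cases "Suc i = length ts")
      case True
      then show ?thesis using ts(2) by (simp add: nth_append last_conv_nth flip: True)
    next
      case False
      then show ?thesis using that ts(5)[of i] by (simp add: nth_append)
    qed
    ultimately have "I Maxi (insert {last ts, w} E)"
      unfolding I_def using forest_insert[OF ts(1) w] ts w'(1)
      by (intro conjI exI[of _ "ts @ [w]"]) auto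
    then show "\<exists>e\<in>legal_moves n cycles E. I Maxi (insert e E)" using w by blast
  next
    show "I q {}"
      using assms by (auto simp: I_def forest_empty intro!: exI[of _ "[0]"])
  qed
  then show ?thesis by simp
qed

section \<open>The lower bound\<close>

definition deg :: "'a set set \<Rightarrow> 'a \<Rightarrow> nat" where
  "deg E u = card {w. {u, w} \<in> E}"

lemma finite_neighbours: "forest n E \<Longrightarrow> finite {w. {u, w} \<in> E}"
  by (rule finite_subset[of _ "{..<n}"]) (auto simp: forest_def all_edges_def)

lemma deg_mono: "forest n E' \<Longrightarrow> E \<subseteq> E' \<Longrightarrow> deg E u \<le> deg E' u"
  unfolding deg_def by (intro card_mono finite_neighbours) auto

lemma deg_insert:
  assumes "forest n E" "{u, w} \<in> legal_moves n cycles E"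
  shows "deg (insert {u, w} E) u = Suc (deg E u)"
proof -
  have "{u, w} \<notin> E" using assms(2) by (simp add: legal_moves_def)
  moreover have "{x. {u, x} \<in> insert {u, w} E} = insert w {x. {u, x} \<in> E}"
    by (auto simp: doubleton_eq_iff)
  ultimately show ?thesis by (simp add: deg_def finite_neighbours[OF assms(1)])
qed

text \<open>With \<open>{u, v}\<close> as middle edge, another neighbour of \<open>u\<close> and
  another neighbour of \<open>v\<close> can be chosen independently. They are distinct because there
  is no triangle.\<close>

lemma score_ge:
  assumes E: "forest n E" and uv: "{u, v} \<in> E"
  shows "(deg E u - 1) * (deg E v - 1) \<le> card (copies (path_graph 4) ({..<n}, E))"
proof -
  define A where "A = {w. {u, w} \<in> E} - {v}"
  define B where "B = {w. {v, w} \<in> E} - {u}"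
  have edge: "x \<noteq> y \<and> x < n \<and> y < n" if "{x, y} \<in> E" for x y
    using that E by (auto simp: forest_def all_edges_def)
  have disj: "a \<noteq> d" if "a \<in> A" "d \<in> B" for a d
  proof
    assume "a = d"
    have "(u, v) \<in> (adj {{u, a}, {a, v}})\<^sup>*"
      by (rule rtrancl_trans[of u a]) (auto intro: conn_edge)
    moreover have "{{u, a}, {a, v}} \<subseteq> E" "{u, v} \<notin> {{u, a}, {a, v}}"
      using that \<open>a = d\<close> edge by (auto simp: A_def B_def doubleton_eq_iff insert_commute)
    ultimately show False using free_of_cyclesD[of "{..<n}" E _ u v] E uv
      unfolding forest_def by blast
  qed
  have card: "card A = deg E u - 1" "card B = deg E v - 1"
    using uv by (simp_all add: A_def B_def deg_def card_Diff_singleton insert_commute)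
  define h where "h = (\<lambda>(a, d). path4 a u v d)"
  have "inj_on h (A \<times> B)"
  proof (rule inj_onI)
    fix x y assume xy: "x \<in> A \<times> B" "y \<in> A \<times> B" "h x = h y"
    obtain a d a' d' where eq: "x = (a, d)" "y = (a', d')" by (cases x; cases y)
    then have *: "a \<in> A" "d \<in> B" "a' \<in> A" "d' \<in> B" "h (a, d) = h (a', d')"
      using xy by auto
    have ne: "a \<noteq> u" "a \<noteq> v" "a' \<noteq> u" "a' \<noteq> v" "d \<noteq> u" "d \<noteq> v" "d' \<noteq> u" "d' \<noteq> v" "u \<noteq> v"
      using * edge uv by (auto simp: A_def B_def)
    have "{{a, u}, {u, v}, {v, d}} = {{a', u}, {u, v}, {v, d'}}"
      using *(5) by (simp add: h_def path4_def)
    \<comment> \<open>The fixed middle edge singles out the end edge at \<open>u\<close> and the one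
      at \<open>v\<close>, so the copy determines both ends.\<close>
    then have "{a, u} \<in> {{a', u}, {u, v}, {v, d'}}" "{v, d} \<in> {{a', u}, {u, v}, {v, d'}}"
      by (metis insertI1, metis insertI1 insertI2)
    then show "x = y" using ne eq by (auto simp: doubleton_eq_iff)
  qed
  moreover have "h ` (A \<times> B) \<subseteq> copies (path_graph 4) ({..<n}, E)"
  proof (rule image_subsetI)
    fix x assume "x \<in> A \<times> B"
    then obtain a d where x: "x = (a, d)" and *: "a \<in> A" "d \<in> B" by blast
    then have "distinct [a, u, v, d]" "{a, u, v, d} \<subseteq> {..<n}" "{{a, u}, {u, v}, {v, d}} \<subseteq> E"
      using disj[OF *] edge uv by (auto simp: A_def B_def insert_commute)
    then show "h x \<in> copies (path_graph 4) ({..<n}, E)"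
      unfolding h_def x by (simp add: path4_in_copies)
  qed
  moreover have "finite (copies (path_graph 4) ({..<n}, E))"
    by (rule finite_subset[of _ "Pow {..<n} \<times> Pow E"])
      (use finite_forest[OF E] in \<open>auto simp: copies_def is_subgraph_def\<close>)
  ultimately have "card (A \<times> B) \<le> card (copies (path_graph 4) ({..<n}, E))"
    by (rule card_inj_on_le)
  then show ?thesis by (simp add: card_cartesian_product card)
qed

text \<open>Max brings first \<open>u\<close> and then \<open>v\<close> to degree \<open>g\<close>.
  The subtracted 1 in the bound discounts the edge \<open>{u, v}\<close> itself.\<close>

lemma game_value_lower:
  assumes n: "n \<ge> 2" and g: "g = (n - 2) div 4"
  shows "(g - 1)\<^sup>2 \<le> game_value n (path_graph 4) cycles q {}"
proof -
  \<comment> \<open>Progress towards both targets, capped so that surplus degree at one end cannot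
    hide a deficit at the other.\<close>
  define f where "f E u v = min (deg E u) g + min (deg E v) g" for E and u v :: nat
  define J where "J q E u v \<longleftrightarrow> forest n E \<and> {u, v} \<in> E \<and>
      (card E \<le> 2 * f E u v + (if q = Maxi then 1 else 0) \<or>
       g \<le> deg E u \<and> g \<le> deg E v)" for q E u v
  \<comment> \<open>The ends \<open>u\<close> and \<open>v\<close> are fixed only by the first move,
    whichever player makes it; hence the separate case of the empty position.\<close>
  define I where "I q E \<longleftrightarrow> E = {} \<or> (\<exists>u v. J q E u v)" for q E
  have single: "I q {e}" if e: "e \<in> legal_moves n cycles {}" for q e
  proof -
    obtain u v where uv: "e = {u, v}"
      using e by (auto simp: legal_moves_def all_edges_def card_2_iff)
    have "{w. {u, w} = {u, v}} = {v}" "{w. {v, w} = {u, v}} = {u}"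
      by (auto simp: doubleton_eq_iff)
    then have "deg {e} u = 1" "deg {e} v = 1" by (simp_all add: deg_def uv)
    then have "J q {e} u v"
      using forest_insert[OF forest_empty e] uv by (auto simp: J_def f_def)
    then show ?thesis by (auto simp: I_def)
  qed
  show ?thesis
  proof (rule game_value_ge[of I])
    fix q E assume I: "I q E" and L: "legal_moves n cycles E = {}"
    have "E \<noteq> {}"
    proof
      assume "E = {}"
      moreover have "(0, 1) \<notin> (adj {} :: nat rel)\<^sup>*" by (simp add: adj_def)
      ultimately show False
        using L legal_moves_cycles_iff[OF forest_empty, of 0 1 n] n by simp
    qed
    then obtain u v where J: "J q E u v" using I by (auto simp: I_def)
    then have E: "forest n E" by (simp add: J_def)
    have "card E = n - 1" using final_tree[OF E L, of 0] n by fastforce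
    \<comment> \<open>The choice of \<open>g\<close> makes this hold. A missed target would leave
      \<open>f\<close> at most \<open>2 * g - 1\<close>, allowing at most \<open>4 * g - 1\<close>
      edges.\<close>
    then have bound: "4 * g + 1 \<le> card E" using n unfolding g by linarith
    have "g \<le> deg E u \<and> g \<le> deg E v"
    proof (rule ccontr)
      assume *: "\<not> (g \<le> deg E u \<and> g \<le> deg E v)"
      have "card E \<le> 2 * f E u v + 1" using J * by (auto simp: J_def split: if_splits)
      moreover have "f E u v < 2 * g" using * by (auto simp: f_def min_def)
      ultimately show False using bound by linarith
    qed
    then have "(g - 1)\<^sup>2 \<le> (deg E u - 1) * (deg E v - 1)"
      unfolding power2_eq_square by (intro mult_mono diff_le_mono) simp_all
    also have "\<dots> \<le> card (copies (path_graph 4) ({..<n}, E))"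
      using score_ge[OF E] J by (simp add: J_def)
    finally show "(g - 1)\<^sup>2 \<le> card (copies (path_graph 4) ({..<n}, E))" .
  next
    fix E e assume I: "I Mini E" and e: "e \<in> legal_moves n cycles E"
    show "I Maxi (insert e E)"
    proof (cases "E = {}")
      case True
      then show ?thesis using single e by simp
    next
      case False
      then obtain u v where J: "J Mini E u v" using I by (auto simp: I_def)
      have E': "forest n (insert e E)" using J e by (auto simp: J_def intro: forest_insert)
      have "card (insert e E) \<le> Suc (card E)" by (rule card_insert_le_m1) auto
      then have "J Maxi (insert e E) u v"
        using J E' deg_mono[OF E' subset_insertI, of u] deg_mono[OF E' subset_insertI, of v]
        by (auto simp: J_def f_def)
      then show ?thesis by (auto simp: I_def)
    qed
  next
    fix E assume I: "I Maxi E" and L: "legal_moves n cycles E \<noteq> {}"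
    show "\<exists>e\<in>legal_moves n cycles E. I Mini (insert e E)"
    proof (cases "E = {}")
      case True
      then show ?thesis using single L by blast
    next
      case False
      then obtain u v where J: "J Maxi E u v" using I by (auto simp: I_def)
      then have E: "forest n E" "u < n" "v < n"
        by (auto simp: J_def forest_def all_edges_def)
      \<comment> \<open>A move that makes progress raises \<open>f\<close> by at least 1, which pays
        for Max's edge and for the edge Mini added before. Once both targets are met, any legal move
        will do.\<close>
      have step: "J Mini (insert e E) u v" if "e \<in> legal_moves n cycles E"
        "deg E u < g \<Longrightarrow> deg E u < deg (insert e E) u"
        "\<not> deg E u < g \<Longrightarrow> deg E v < g \<Longrightarrow> deg E v < deg (insert e E) v" for e
      proof -
        have E': "forest n (insert e E)" using E that(1) by (intro forest_insert)
        have mono: "deg E u \<le> deg (insert e E) u" "deg E v \<le> deg (insert e E) v"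
          by (intro deg_mono[OF E'] subset_insertI)+
        have card: "card (insert e E) \<le> Suc (card E)" by (rule card_insert_le_m1) auto
        show ?thesis
        proof (cases "g \<le> deg E u \<and> g \<le> deg E v")
          case True
          then show ?thesis using J E' mono by (auto simp: J_def)
        next
          case False
          then have "f E u v < f (insert e E) u v"
            unfolding f_def
            using that(2,3) mono by (cases "deg E u < g") (auto simp: min_def)
          moreover have "card E \<le> 2 * f E u v + 1"
            using J False by (auto simp: J_def)
          ultimately have "card (insert e E) \<le> 2 * f (insert e E) u v"
            using card by linarith
          then show ?thesis using J E' by (simp add: J_def)
        qed
      qed
      obtain x y where x: "{u, x} \<in> legal_moves n cycles E" "{v, y} \<in> legal_moves n cycles E"
        using ex_legal_move_from[OF E(1) L] E(2,3) by blast
      show ?thesis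
      proof (cases "deg E u < g")
        case True
        then have "J Mini (insert {u, x} E) u v"
          using x(1) by (intro step) (auto simp: deg_insert[OF E(1) x(1)])
        then show ?thesis using x by (auto simp: I_def)
      next
        case False
        \<comment> \<open>This also covers the case where both targets are met.\<close>
        then have "J Mini (insert {v, y} E) u v"
          using x(2) by (intro step) (auto simp: deg_insert[OF E(1) x(2)])
        then show ?thesis using x by (auto simp: I_def)
      qed
    qed
  next
    show "I q {}" by (simp add: I_def)
  qed
qed

section \<open>The two bounds combined\<close>

lemma game_value_asymp:
  "(\<lambda>n. real (game_value n (path_graph 4) cycles q {}) - (real n)\<^sup>2 / 16) \<in> O(\<lambda>n. real n)"
proof (rule bigoI[of _ 2], rule eventually_mono[OF eventually_ge_at_top[of 9]])
  fix n :: nat assume n: "n \<ge> 9"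
  let ?s = "game_value n (path_graph 4) cycles q {}"
  have "16 * ?s \<le> n\<^sup>2 + 32 * n" using game_value_upper n by simp
  then have "16 * real ?s \<le> (real n)\<^sup>2 + 32 * real n"
    by (metis (mono_tags) of_nat_add of_nat_le_iff of_nat_mult of_nat_numeral of_nat_power)
  moreover have "(real n)\<^sup>2 / 16 - 2 * real n \<le> real ?s"
  proof -
    define k where "k = (n - 2) div 4 - 1"
    \<comment> \<open>Rounding in the division loses at most 3, and the two subtractions account for
      2 and 4. The resulting \<open>(n - 9)^2 / 16\<close> loses less than \<open>2 * n\<close>, and
      \<open>n \<ge> 9\<close> keeps the base of the square nonnegative.\<close>
    have "n \<le> 4 * k + 9" using n unfolding k_def by linarith
    then have "(real n - 9)\<^sup>2 \<le> (4 * real k)\<^sup>2" using n by (intro power_mono) auto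
    moreover have "k\<^sup>2 \<le> ?s"
      unfolding k_def using n by (intro game_value_lower) simp_all
    then have "(real k)\<^sup>2 \<le> real ?s" by (simp flip: of_nat_power)
    ultimately show ?thesis by (simp add: power2_eq_square algebra_simps)
  qed
  ultimately show "norm (real ?s - (real n)\<^sup>2 / 16) \<le> 2 * norm (real n)"
    by (simp add: abs_le_iff)
qed

theorem theorem1p6:
  "(\<lambda>n. real (sat_score\<^sub>1 n (path_graph 4) cycles) - (real n)\<^sup>2 / 16) \<in> O(\<lambda>n. real n) \<and>
   (\<lambda>n. real (sat_score\<^sub>2 n (path_graph 4) cycles) - (real n)\<^sup>2 / 16) \<in> O(\<lambda>n. real n)"
  unfolding sat_score\<^sub>1_def sat_score\<^sub>2_def using game_value_asymp by blast

end
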